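(* Let $\kappa$ be an infinite cardinal and $2\leq n<\omega$. Then there is an orientation $D$ of $\mathrm{Sh}_n(\exp_n(\kappa))$ such that for every colouring of the vertices of $D$ with $\kappa$ colours there is a monochromatic copy of $\vec C_4$ in $D$. In particular, $\vec\chi(\mathrm{Sh}_n(\exp_n(\kappa)))>\kappa$.
   Context: $\exp_0(\kappa)=\kappa$ and $\exp_{m+1}(\kappa)=2^{\exp_m(\kappa)}$. For an ordinal $\lambda$, the shift graph $\mathrm{Sh}_n(\lambda)$ has vertex set $[\lambda]^n$ and edges $\{\xi_i:i<n\}\{\xi_j:1\leq j<n+1\}$ for all $\xi_0<\dots<\xi_n<\lambda$. An orientation of an undirected graph $G$ is a digraph on the same vertex set containing, for each edge $uv$ of $G$, exactly one of the arcs $uv$, $vu$, and no other arcs. $\vec C_4$ is the directed 4-cycle; copies need not be induced. $\vec\chi(G)=\sup\{\chi(D): D$ an orientation of $G\}$, where $\chi(D)$ is the minimal number of acyclic vertex sets (sets inducing no directed cycle) covering the vertices of $D$. *)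

theory Defs
  imports Main
begin

text \<open>Cardinal exponentiation: exp_card m K V holds iff |V| = exp_m(|K|),
  where exp_0(k) = k and exp_(m+1)(k) = 2^(exp_m(k)) = |Pow (a set of size exp_m(k))|.\<close>
fun exp_card :: "nat \<Rightarrow> 'k set \<Rightarrow> 'v set \<Rightarrow> bool" where
  "exp_card 0 K V = ((card_of V, card_of K) \<in> ordIso)"
| "exp_card (Suc m) K V = (\<exists>C :: 'v set. exp_card m K C \<and> (card_of V, card_of (Pow C)) \<in> ordIso)"

definition shift_vertices :: "'v rel \<Rightarrow> nat \<Rightarrow> 'v set set" where
  "shift_vertices r n = {X. X \<subseteq> Field r \<and> finite X \<and> card X = n}"

definition shift_edge :: "'v rel \<Rightarrow> nat \<Rightarrow> 'v set \<Rightarrow> 'v set \<Rightarrow> bool" where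
  "shift_edge r n X Y \<longleftrightarrow> (\<exists>xs :: nat \<Rightarrow> 'v.
      (\<forall>i\<le>n. xs i \<in> Field r) \<and>
      (\<forall>i<n. (xs i, xs (Suc i)) \<in> r \<and> xs i \<noteq> xs (Suc i)) \<and>
      X = xs ` {0..<n} \<and> Y = xs ` {1..n})"

definition is_orientation :: "'v rel \<Rightarrow> nat \<Rightarrow> ('v set \<times> 'v set) set \<Rightarrow> bool" where
  "is_orientation r n D \<longleftrightarrow>
     (\<forall>X Y. shift_edge r n X Y \<longrightarrow> ((X, Y) \<in> D \<longleftrightarrow> (Y, X) \<notin> D)) \<and>
     (\<forall>(X, Y) \<in> D. shift_edge r n X Y \<or> shift_edge r n Y X)"

definition has_C4_in :: "('w \<times> 'w) set \<Rightarrow> 'w set \<Rightarrow> bool" where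
  "has_C4_in D A \<longleftrightarrow> (\<exists>a b c d. a \<in> A \<and> b \<in> A \<and> c \<in> A \<and> d \<in> A \<and>
      distinct [a, b, c, d] \<and> (a, b) \<in> D \<and> (b, c) \<in> D \<and> (c, d) \<in> D \<and> (d, a) \<in> D)"

definition acyclic_set :: "('w \<times> 'w) set \<Rightarrow> 'w set \<Rightarrow> bool" where
  "acyclic_set D A \<longleftrightarrow> acyclic (D \<inter> (A \<times> A))"

end

theory Submission
  imports Defs
begin

text \<open>
  Call a colouring \<open>p\<close> of the edges of a digraph by a set \<open>S\<close> \<^emph>\<open>matching\<close> if every colouring of the
  vertices by \<open>S \<times> S\<close> has an edge both of whose ends receive the same pair \<open>(p e, t)\<close>.
  If \<open>S'\<close> is identified with the sequences of length \<open>S\<close> over an alphabet of more than \<open>|S|\<close>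
  letters, then colouring the pairs of \<open>S'\<close> by their first difference is matching: otherwise
  one builds, letter by letter, a sequence that no colour class contains.
  The same property passes from a digraph with a matching colouring \<open>p\<close> by \<open>S'\<close> to its line
  digraph, with the colour of \<open>u v w\<close> being the first difference of \<open>p (u v)\<close> and \<open>p (v w)\<close>. Since
  the shift graph on \<open>(m+1)\<close>-tuples is the line digraph of the one on \<open>m\<close>-tuples, each step uses
  up one exponential, and the shift graph on \<open>(n-1)\<close>-tuples has a matching colouring \<open>p\<close> by
  \<open>S = 2\<^sup>K\<close>. In the last step the edge \<open>u v w\<close> is oriented according to the two letters at which
  \<open>p (u v)\<close> and \<open>p (v w)\<close> first differ, along a 4-cycle of letters.
\<close>

section \<open>Diagonalisation\<close>

text \<open>Recursion along \<open>R\<close>: once the letters below \<open>a\<close> are fixed,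
  \<open>avoid\<close> supplies a letter at \<open>a\<close> that no \<open>x\<close> with these
  earlier letters and \<open>Q x a\<close> carries. An element coding the resulting sequence
  satisfies \<open>Q\<close> at no point of \<open>A\<close>.\<close>

lemma diagonal_avoidance:
  fixes e :: "'b \<Rightarrow> 'a \<Rightarrow> 'a set" and Q :: "'b \<Rightarrow> 'a \<Rightarrow> bool"
  assumes "wf R" and "R \<subseteq> A \<times> A"
    and surj: "\<forall>F. (\<forall>a\<in>A. F a \<subseteq> A) \<longrightarrow> (\<exists>x\<in>B. \<forall>a\<in>A. e x a = F a)"
    and avoid: "\<And>a s. a \<in> A \<Longrightarrow>
      \<exists>j\<subseteq>A. \<not> (\<exists>x\<in>B. (\<forall>b. (b, a) \<in> R \<longrightarrow> e x b = s b) \<and> e x a = j \<and> Q x a)"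
  obtains x where "x \<in> B" and "\<And>a. a \<in> A \<Longrightarrow> \<not> Q x a"
proof -
  let ?P = "\<lambda>s a j. a \<in> A \<longrightarrow> j \<subseteq> A \<and>
    \<not> (\<exists>x\<in>B. (\<forall>b. (b, a) \<in> R \<longrightarrow> e x b = s b) \<and> e x a = j \<and> Q x a)"
  have "\<exists>F. \<forall>a. ?P F a (F a)"
  proof (rule dependent_wf_choice[OF \<open>wf R\<close>])
    show "?P f x j = ?P g x j" if "\<And>z. (z, x) \<in> R \<Longrightarrow> f z = g z" for f g x j
      using that by auto
    show "\<exists>j. ?P f x j" for x f
      using avoid[of x f] by blast
  qed
  then obtain F where F: "\<And>a. ?P F a (F a)"
    by blast
  with surj[rule_format, of F] obtain x where x: "x \<in> B" "\<And>a. a \<in> A \<Longrightarrow> e x a = F a"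
    by blast
  have "\<not> Q x a" if "a \<in> A" for a
    using F[of a] x that \<open>R \<subseteq> A \<times> A\<close> by blast
  with x(1) show thesis
    by (rule that)
qed

text \<open>The value lies in \<open>A\<close> even when \<open>f\<close> and \<open>g\<close> agree on \<open>A\<close>.\<close>

definition first_diff :: "'a rel \<Rightarrow> 'a set \<Rightarrow> ('a \<Rightarrow> 'c) \<Rightarrow> ('a \<Rightarrow> 'c) \<Rightarrow> 'a" where
  "first_diff R A f g =
     (SOME a. a \<in> A \<and> ((\<exists>b\<in>A. f b \<noteq> g b) \<longrightarrow> f a \<noteq> g a \<and> (\<forall>b. (b, a) \<in> R \<longrightarrow> f b = g b)))"

lemma first_diff_commute: "first_diff R A f g = first_diff R A g f"
  unfolding first_diff_def by (metis (no_types, lifting))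

lemma first_diff_in:
  assumes "wf R" "R \<subseteq> A \<times> A" "A \<noteq> {}"
  shows "first_diff R A f g \<in> A"
    and "b \<in> A \<Longrightarrow> f b \<noteq> g b \<Longrightarrow> f (first_diff R A f g) \<noteq> g (first_diff R A f g)"
    and "b \<in> A \<Longrightarrow> f b \<noteq> g b \<Longrightarrow> (c, first_diff R A f g) \<in> R \<Longrightarrow> f c = g c"
proof -
  let ?P = "\<lambda>a. a \<in> A \<and> ((\<exists>b\<in>A. f b \<noteq> g b) \<longrightarrow> f a \<noteq> g a \<and> (\<forall>b. (b, a) \<in> R \<longrightarrow> f b = g b))"
  have "\<exists>a. ?P a"
  proof (cases "\<exists>b\<in>A. f b \<noteq> g b")
    case True
    then obtain b where "b \<in> {b\<in>A. f b \<noteq> g b}" by blast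
    with \<open>wf R\<close> obtain a where "a \<in> {b\<in>A. f b \<noteq> g b}"
      "\<And>y. (y, a) \<in> R \<Longrightarrow> y \<notin> {b\<in>A. f b \<noteq> g b}"
      by (rule wfE_min) blast
    then show ?thesis
      using \<open>R \<subseteq> A \<times> A\<close> by blast
  next
    case False
    then show ?thesis using \<open>A \<noteq> {}\<close> by blast
  qed
  then have *: "?P (first_diff R A f g)"
    unfolding first_diff_def by (rule someI_ex)
  show "first_diff R A f g \<in> A"
    using * by blast
  show "b \<in> A \<Longrightarrow> f b \<noteq> g b \<Longrightarrow> f (first_diff R A f g) \<noteq> g (first_diff R A f g)"
    using * by blast
  show "b \<in> A \<Longrightarrow> f b \<noteq> g b \<Longrightarrow> (c, first_diff R A f g) \<in> R \<Longrightarrow> f c = g c"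
    using * by blast
qed

lemma first_diff_eqI:
  assumes "wf R" "R \<subseteq> A \<times> A" "\<And>b c. b \<in> A \<Longrightarrow> c \<in> A \<Longrightarrow> b \<noteq> c \<Longrightarrow> (b, c) \<in> R \<or> (c, b) \<in> R"
    and a: "a \<in> A" "f a \<noteq> g a" "\<And>b. (b, a) \<in> R \<Longrightarrow> f b = g b"
  shows "first_diff R A f g = a"
proof (rule ccontr)
  let ?d = "first_diff R A f g"
  have "A \<noteq> {}" using a by blast
  note d = first_diff_in[OF assms(1,2) this, where f = f and g = g]
  assume "?d \<noteq> a"
  with assms(3) d(1) a(1) have "(?d, a) \<in> R \<or> (a, ?d) \<in> R" by blast
  then show False
    using d(2,3)[OF a(1,2)] a by blast
qed

section \<open>Power sets as sets of sequences\<close>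

lemma strict_well_order_exists:
  obtains R where "wf R" and "R \<subseteq> A \<times> A"
    and "\<And>b c. b \<in> A \<Longrightarrow> c \<in> A \<Longrightarrow> b \<noteq> c \<Longrightarrow> (b, c) \<in> R \<or> (c, b) \<in> R"
proof -
  obtain W where "well_order_on A W"
    using well_order_on by blast
  then have "wf (W - Id)" "W \<subseteq> A \<times> A" "total_on A W"
    unfolding well_order_on_def linear_order_on_def partial_order_on_def preorder_on_def
    by (auto simp: refl_on_def)
  then show thesis
    by (intro that[of "W - Id"]) (auto simp: total_on_def)
qed

text \<open>Subsets of \<open>A \<times> A\<close> serve in two ways: as sequences of subsets of
  \<open>A\<close>, and as sets of colours that are themselves pairs.\<close>

lemma bij_betw_Pow_square:
  assumes "infinite A" and "(card_of B, card_of (Pow A)) \<in> ordIso"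
  obtains f where "bij_betw f B (Pow (A \<times> A))"
proof -
  obtain h where h: "bij_betw h B (Pow A)"
    using assms(2) card_of_ordIso by blast
  obtain k where "bij_betw k A (A \<times> A)"
    using card_of_Times_same_infinite[OF assms(1)] card_of_ordIso ordIso_symmetric by blast
  then have "bij_betw (image k) (Pow A) (Pow (A \<times> A))"
    by (rule bij_betw_Pow)
  with h show thesis
    using bij_betw_trans that by blast
qed

text \<open>A subset of \<open>A \<times> A\<close> is read as the sequence of its vertical slices.
  The alphabet is thus \<open>Pow A\<close>, with more letters than there are positions.\<close>

lemma slice_coding_exists:
  assumes "infinite A" and "(card_of B, card_of (Pow A)) \<in> ordIso"
  obtains e :: "'b \<Rightarrow> 'a \<Rightarrow> 'a set"
  where "\<forall>F. (\<forall>a\<in>A. F a \<subseteq> A) \<longrightarrow> (\<exists>x\<in>B. \<forall>a\<in>A. e x a = F a)"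
proof -
  obtain f where f: "bij_betw f B (Pow (A \<times> A))"
    using bij_betw_Pow_square[OF assms] by blast
  show thesis
  proof (rule that[of "\<lambda>x a. {b. (a, b) \<in> f x}"], intro allI impI)
    fix F :: "'a \<Rightarrow> 'a set"
    assume F: "\<forall>a\<in>A. F a \<subseteq> A"
    then have "(SIGMA a:A. F a) \<in> f ` B"
      using f by (auto simp: bij_betw_def)
    then obtain x where "x \<in> B" "f x = (SIGMA a:A. F a)"
      by force
    then show "\<exists>x\<in>B. \<forall>a\<in>A. {b. (a, b) \<in> f x} = F a"
      by (intro bexI[of _ x]) auto
  qed
qed

text \<open>\<open>d\<close> is the first difference of the coded sequences. Suppose no pair works,
  and fix \<open>a\<close> and a prefix below it. Elements whose colour begins with \<open>a\<close>
  cannot realise every letter at \<open>a\<close>: any two with different letters first differ at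
  \<open>a\<close>, so their second components would inject \<open>Pow A\<close> into
  \<open>A\<close>. Diagonalisation then gives an \<open>x\<close> whose colour begins with no
  element of \<open>A\<close>.\<close>

lemma splitting_function_exists:
  assumes "infinite A" and "(card_of B, card_of (Pow A)) \<in> ordIso"
  obtains d :: "'b \<Rightarrow> 'b \<Rightarrow> 'a"
  where "\<forall>x y. d x y \<in> A" and "\<forall>x y. d x y = d y x"
    and "\<forall>C :: 'b \<Rightarrow> 'a \<times> 'a. (\<forall>x\<in>B. C x \<in> A \<times> A) \<longrightarrow>
      (\<exists>x\<in>B. \<exists>y\<in>B. x \<noteq> y \<and> C x = C y \<and> fst (C x) = d x y)"
proof -
  obtain R where R: "wf R" "R \<subseteq> A \<times> A"
    "\<And>b c. b \<in> A \<Longrightarrow> c \<in> A \<Longrightarrow> b \<noteq> c \<Longrightarrow> (b, c) \<in> R \<or> (c, b) \<in> R"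
    using strict_well_order_exists[of A] by blast
  obtain e :: "'b \<Rightarrow> 'a \<Rightarrow> 'a set"
    where e: "\<forall>F. (\<forall>a\<in>A. F a \<subseteq> A) \<longrightarrow> (\<exists>x\<in>B. \<forall>a\<in>A. e x a = F a)"
    by (rule slice_coding_exists[OF assms])
  define d where "d x y = first_diff R A (e x) (e y)" for x y
  have "A \<noteq> {}" using \<open>infinite A\<close> by auto
  show thesis
  proof (rule that[of d])
    show "\<forall>x y. d x y \<in> A"
      unfolding d_def using first_diff_in(1)[OF R(1,2) \<open>A \<noteq> {}\<close>] by blast
    show "\<forall>x y. d x y = d y x"
      unfolding d_def using first_diff_commute by blast
    show "\<forall>C :: 'b \<Rightarrow> 'a \<times> 'a. (\<forall>x\<in>B. C x \<in> A \<times> A) \<longrightarrow>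
      (\<exists>x\<in>B. \<exists>y\<in>B. x \<noteq> y \<and> C x = C y \<and> fst (C x) = d x y)"
    proof (intro allI impI)
      fix C :: "'b \<Rightarrow> 'a \<times> 'a"
      assume C: "\<forall>x\<in>B. C x \<in> A \<times> A"
      show "\<exists>x\<in>B. \<exists>y\<in>B. x \<noteq> y \<and> C x = C y \<and> fst (C x) = d x y"
      proof (rule ccontr)
        assume neg: "\<not> ?thesis"
        have "\<exists>j\<subseteq>A. \<not> (\<exists>x\<in>B. (\<forall>b. (b, a) \<in> R \<longrightarrow> e x b = s b) \<and> e x a = j \<and> fst (C x) = a)"
          if "a \<in> A" for a s
        proof (rule ccontr)
          assume "\<not> ?thesis"
          then have "\<forall>j\<in>Pow A. \<exists>x\<in>B. (\<forall>b. (b, a) \<in> R \<longrightarrow> e x b = s b) \<and> e x a = j \<and> fst (C x) = a"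
            by blast
          then have "\<exists>x. \<forall>j\<in>Pow A.
              x j \<in> B \<and> (\<forall>b. (b, a) \<in> R \<longrightarrow> e (x j) b = s b) \<and> e (x j) a = j \<and> fst (C (x j)) = a"
            unfolding Bex_def by (rule bchoice)
          then obtain x where "\<forall>j\<in>Pow A.
              x j \<in> B \<and> (\<forall>b. (b, a) \<in> R \<longrightarrow> e (x j) b = s b) \<and> e (x j) a = j \<and> fst (C (x j)) = a"
            by (rule exE)
          note x = bspec[OF this]
          have "inj_on (\<lambda>j. snd (C (x j))) (Pow A)"
          proof (rule inj_onI, rule ccontr)
            fix i j assume ij: "i \<in> Pow A" "j \<in> Pow A" "snd (C (x i)) = snd (C (x j))" "i \<noteq> j"
            have "d (x i) (x j) = a"
              unfolding d_def
              by (rule first_diff_eqI[OF R that]) (use x[OF ij(1)] x[OF ij(2)] ij(4) in simp_all)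
            moreover have "C (x i) = C (x j)"
              using x[OF ij(1)] x[OF ij(2)] ij(3) by (intro prod_eqI) simp_all
            moreover have "x i \<noteq> x j"
              using x[OF ij(1)] x[OF ij(2)] ij(4) by metis
            ultimately show False
              using neg x[OF ij(1)] x[OF ij(2)] by blast
          qed
          moreover have "(\<lambda>j. snd (C (x j))) ` Pow A \<subseteq> A"
            using x C by (auto simp: mem_Times_iff)
          ultimately have "\<exists>f. f ` A = Pow A"
            using inj_on_iff_surj[of "Pow A" A] by blast
          then show False
            using Cantors_theorem by blast
        qed
        from diagonal_avoidance[OF R(1,2) e this] obtain x
          where "x \<in> B" "\<And>a. a \<in> A \<Longrightarrow> \<not> fst (C x) = a"
          by blast
        with C show False
          by (auto simp: mem_Times_iff)
      qed
    qed
  qed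
qed

text \<open>If after some prefix below some \<open>a\<close> every letter at \<open>a\<close> occurs
  with colour \<open>a\<close>, four suitable letters give the quadruple. Otherwise diagonalisation
  gives an element whose colour is not in \<open>A\<close>.\<close>

lemma alternating_relation_exists:
  assumes "infinite A" and "(card_of B, card_of (Pow A)) \<in> ordIso"
  obtains g :: "'b \<Rightarrow> 'b \<Rightarrow> bool"
  where "\<forall>C :: 'b \<Rightarrow> 'a. (\<forall>x\<in>B. C x \<in> A) \<longrightarrow>
    (\<exists>x\<in>B. \<exists>x'\<in>B. \<exists>y\<in>B. \<exists>y'\<in>B. C x = C y \<and> C x' = C y \<and> C y' = C y \<and>
      g x y \<and> \<not> g x' y \<and> g x' y' \<and> \<not> g x y')"
proof -
  obtain R where R: "wf R" "R \<subseteq> A \<times> A"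
    "\<And>b c. b \<in> A \<Longrightarrow> c \<in> A \<Longrightarrow> b \<noteq> c \<Longrightarrow> (b, c) \<in> R \<or> (c, b) \<in> R"
    using strict_well_order_exists[of A] by blast
  obtain e :: "'b \<Rightarrow> 'a \<Rightarrow> 'a set"
    where e: "\<forall>F. (\<forall>a\<in>A. F a \<subseteq> A) \<longrightarrow> (\<exists>x\<in>B. \<forall>a\<in>A. e x a = F a)"
    by (rule slice_coding_exists[OF assms])
  obtain u where u: "u \<in> A"
    using \<open>infinite A\<close> by fastforce
  obtain v where v: "v \<in> A" "v \<noteq> u"
    using infinite_imp_nonempty[OF infinite_remove[OF \<open>infinite A\<close>, of u]] by blast
  \<comment> \<open>The letters run around the 4-cycle \<open>{}\<close>, \<open>{u}\<close>,
    \<open>{v}\<close>, \<open>{u, v}\<close>. \<open>g\<close> holds on its first and third steps;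
    the other two, reversed, are \<open>({v}, {u})\<close> and \<open>({}, {u, v})\<close>, where it
    fails.\<close>
  define g where "g x y \<longleftrightarrow> (let a = first_diff R A (e x) (e y) in
    (e x a, e y a) \<in> {({}, {u}), ({v}, {u, v})})" for x y
  show thesis
  proof (rule that[of g], intro allI impI)
    fix C :: "'b \<Rightarrow> 'a"
    assume C: "\<forall>x\<in>B. C x \<in> A"
    show "\<exists>x\<in>B. \<exists>x'\<in>B. \<exists>y\<in>B. \<exists>y'\<in>B. C x = C y \<and> C x' = C y \<and> C y' = C y \<and>
      g x y \<and> \<not> g x' y \<and> g x' y' \<and> \<not> g x y'"
    proof (rule ccontr)
      assume neg: "\<not> ?thesis"
      have "\<exists>j\<subseteq>A. \<not> (\<exists>x\<in>B. (\<forall>b. (b, a) \<in> R \<longrightarrow> e x b = s b) \<and> e x a = j \<and> C x = a)"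
        if "a \<in> A" for a s
      proof (rule ccontr)
        assume "\<not> ?thesis"
        then have "\<forall>j\<in>Pow A. \<exists>x\<in>B. (\<forall>b. (b, a) \<in> R \<longrightarrow> e x b = s b) \<and> e x a = j \<and> C x = a"
          by blast
        then have "\<exists>x. \<forall>j\<in>Pow A.
            x j \<in> B \<and> (\<forall>b. (b, a) \<in> R \<longrightarrow> e (x j) b = s b) \<and> e (x j) a = j \<and> C (x j) = a"
          unfolding Bex_def by (rule bchoice)
        then obtain x where "\<forall>j\<in>Pow A.
            x j \<in> B \<and> (\<forall>b. (b, a) \<in> R \<longrightarrow> e (x j) b = s b) \<and> e (x j) a = j \<and> C (x j) = a"
          by (rule exE)
        note x = bspec[OF this]
        have diff: "first_diff R A (e (x i)) (e (x j)) = a"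
          if "i \<in> Pow A" "j \<in> Pow A" "i \<noteq> j" for i j
          by (rule first_diff_eqI[OF R \<open>a \<in> A\<close>])
            (use x[OF that(1)] x[OF that(2)] that(3) in simp_all)
        have g: "g (x i) (x j) \<longleftrightarrow> (i, j) \<in> {({}, {u}), ({v}, {u, v})}"
          if "i \<in> Pow A" "j \<in> Pow A" "i \<noteq> j" for i j
          unfolding g_def using diff[OF that] x[OF that(1)] x[OF that(2)] by simp
        have in_Pow: "{} \<in> Pow A" "{u} \<in> Pow A" "{v} \<in> Pow A" "{u, v} \<in> Pow A"
          using u v by auto
        have "g (x {}) (x {u})" "\<not> g (x {v}) (x {u})" "g (x {v}) (x {u, v})"
          "\<not> g (x {}) (x {u, v})"
          using v(2) by (subst g; use in_Pow in auto)+
        moreover have "x {} \<in> B" "x {v} \<in> B" "x {u} \<in> B" "x {u, v} \<in> B"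
          "C (x {}) = a" "C (x {v}) = a" "C (x {u}) = a" "C (x {u, v}) = a"
          using x in_Pow by blast+
        ultimately show False
          using neg by (smt (verit))
      qed
      from diagonal_avoidance[OF R(1,2) e this] obtain x
        where "x \<in> B" "\<And>a. a \<in> A \<Longrightarrow> \<not> C x = a"
        by blast
      with C show False
        by blast
    qed
  qed
qed


section \<open>Increasing tuples\<close>

definition inc_lists :: "'v rel \<Rightarrow> nat \<Rightarrow> 'v list set" where
  "inc_lists r m = {xs. length xs = m \<and> set xs \<subseteq> Field r \<and>
     sorted_wrt (\<lambda>x y. (x, y) \<in> r \<and> x \<noteq> y) xs}"

lemma inc_lists_tl: "ys \<in> inc_lists r (Suc m) \<Longrightarrow> tl ys \<in> inc_lists r m"
  by (cases ys) (auto simp: inc_lists_def)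

text \<open>This is the line digraph structure: consecutive edges form an edge one level up. The
  common part is nonempty because \<open>1 \<le> m\<close>, so transitivity through one of its
  entries compares the two outer entries.\<close>

lemma inc_lists_glue:
  assumes "trans r" "antisym r" and "1 \<le> m"
    and e: "e \<in> inc_lists r (Suc m)" and e': "e' \<in> inc_lists r (Suc m)" and eq: "tl e = butlast e'"
  obtains zs where "zs \<in> inc_lists r (Suc (Suc m))" "butlast zs = e" "tl zs = e'"
proof -
  obtain x v where xv: "e = x # v"
    using e by (cases e) (auto simp: inc_lists_def)
  obtain w where w: "e' = v @ [w]"
    using e' eq xv by (cases e' rule: rev_cases) (auto simp: inc_lists_def)
  have "v \<noteq> []"
    using e xv \<open>1 \<le> m\<close> by (auto simp: inc_lists_def)
  then obtain y where y: "y \<in> set v"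
    by (cases v) auto
  then have "(x, y) \<in> r" "x \<noteq> y" "(y, w) \<in> r" "y \<noteq> w"
    using e e' xv w by (auto simp: inc_lists_def sorted_wrt_append)
  then have "(x, w) \<in> r" "x \<noteq> w"
    using \<open>trans r\<close> \<open>antisym r\<close> by (auto dest: transD antisymD)
  then have "x # v @ [w] \<in> inc_lists r (Suc (Suc m))"
    using e e' xv w by (auto simp: inc_lists_def sorted_wrt_append)
  then show thesis
    using xv w by (intro that[of "x # v @ [w]"]) auto
qed

text \<open>Different heads would each occur in the tail of the other list, hence precede each
  other. This lets lists stand for the sets that are the actual vertices.\<close>

lemma inc_lists_set_inject:
  assumes "antisym r" and "xs \<in> inc_lists r m" "ys \<in> inc_lists r k" "set xs = set ys"
  shows "xs = ys"
  using assms(2-)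
proof (induction xs arbitrary: ys m k)
  case Nil
  then show ?case by simp
next
  case (Cons x xs)
  then obtain y ys' where ys: "ys = y # ys'"
    by (cases ys) auto
  have "x = y"
  proof (rule ccontr)
    assume "x \<noteq> y"
    then have "x \<in> set ys'" "y \<in> set xs"
      using Cons.prems(3) ys by auto
    then have "(x, y) \<in> r" "(y, x) \<in> r"
      using Cons.prems(1,2) ys by (auto simp: inc_lists_def)
    with \<open>x \<noteq> y\<close> \<open>antisym r\<close> show False
      by (auto dest: antisymD)
  qed
  moreover have "x \<notin> set xs" "y \<notin> set ys'"
    using Cons.prems(1,2) ys by (auto simp: inc_lists_def)
  ultimately have "set xs = set ys'"
    using Cons.prems(3) ys by auto
  moreover have "xs \<in> inc_lists r (length xs)" "ys' \<in> inc_lists r (length ys')"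
    using Cons.prems(1,2) ys by (auto simp: inc_lists_def)
  ultimately show ?case
    using Cons.IH \<open>x = y\<close> ys by blast
qed

lemma inc_lists_distinct: "xs \<in> inc_lists r m \<Longrightarrow> distinct xs"
  by (auto simp: inc_lists_def distinct_conv_nth sorted_wrt_iff_nth_less)
     (metis linorder_neqE_nat)

lemma inc_lists_set_vertex: "xs \<in> inc_lists r m \<Longrightarrow> set xs \<in> shift_vertices r m"
  using inc_lists_distinct[of xs r m] distinct_card[of xs]
  by (auto simp: inc_lists_def shift_vertices_def)

lemma inc_lists_hd_notin_tl: "ys \<in> inc_lists r (Suc m) \<Longrightarrow> hd ys \<notin> set (tl ys)"
  by (cases ys) (auto simp: inc_lists_def)

lemma inc_lists_Un_butlast_tl:
  assumes "ys \<in> inc_lists r (Suc m)" "1 \<le> m"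
  shows "set (butlast ys) \<union> set (tl ys) = set ys"
  using assms by (cases ys; cases "tl ys" rule: rev_cases) (auto simp: inc_lists_def)

lemma inc_lists_butlast_noteq_tl:
  assumes "ys \<in> inc_lists r (Suc m)" "1 \<le> m"
  shows "set (butlast ys) \<noteq> set (tl ys)"
proof -
  have "hd ys \<in> set (butlast ys)"
    using assms by (cases ys; cases "tl ys") (auto simp: inc_lists_def)
  then show ?thesis
    using inc_lists_hd_notin_tl[OF assms(1)] by blast
qed

section \<open>Shift edges and their orientations\<close>

lemma shift_edge_iff_inc_lists:
  assumes "trans r" "antisym r"
  shows "shift_edge r n X Y \<longleftrightarrow>
    (\<exists>ys\<in>inc_lists r (Suc n). X = set (butlast ys) \<and> Y = set (tl ys))"
proof
  assume "shift_edge r n X Y"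
  then obtain xs where xs: "\<forall>i\<le>n. xs i \<in> Field r"
      "\<forall>i<n. (xs i, xs (Suc i)) \<in> r \<and> xs i \<noteq> xs (Suc i)"
      "X = xs ` {0..<n}" "Y = xs ` {1..n}"
    unfolding shift_edge_def by blast
  \<comment> \<open>\<open>shift_edge\<close> compares neighbouring entries only; induction on the
    distance covers all pairs.\<close>
  have lt: "(xs i, xs j) \<in> r \<and> xs i \<noteq> xs j" if "i < j" "j \<le> n" for i j
    using that
  proof (induction j)
    case (Suc j)
    then have "(xs j, xs (Suc j)) \<in> r \<and> xs j \<noteq> xs (Suc j)"
      using xs(2) by simp
    with Suc show ?case
      using assms by (cases "i = j") (auto dest: transD antisymD)
  qed simp
  have "map xs [0..<Suc n] \<in> inc_lists r (Suc n)"
    using xs(1) lt by (auto simp: inc_lists_def sorted_wrt_iff_nth_less simp del: upt_Suc)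
  moreover have "X = set (butlast (map xs [0..<Suc n]))"
    using xs(3) by simp
  moreover have "tl (map xs [0..<Suc n]) = map xs [1..<Suc n]"
    by (simp add: map_tl[symmetric] tl_upt del: upt_Suc)
  then have "Y = set (tl (map xs [0..<Suc n]))"
    using xs(4) by (simp add: atLeastLessThanSuc_atLeastAtMost del: upt_Suc)
  ultimately show "\<exists>ys\<in>inc_lists r (Suc n). X = set (butlast ys) \<and> Y = set (tl ys)"
    by blast
next
  assume "\<exists>ys\<in>inc_lists r (Suc n). X = set (butlast ys) \<and> Y = set (tl ys)"
  then obtain ys where ys: "ys \<in> inc_lists r (Suc n)" "X = set (butlast ys)" "Y = set (tl ys)"
    by blast
  then have len: "length ys = Suc n"
    by (simp add: inc_lists_def)
  have "butlast ys = map ((!) ys) [0..<n]" "tl ys = map ((!) ys) [Suc 0..<Suc n]"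
    using len by (auto intro!: nth_equalityI simp: nth_butlast nth_tl simp del: upt_Suc)
  then have "X = (!) ys ` {0..<n}" "Y = (!) ys ` {1..n}"
    using ys(2,3) by (auto simp: atLeastLessThanSuc_atLeastAtMost simp del: upt_Suc)
  then show "shift_edge r n X Y"
    unfolding shift_edge_def using ys(1) len
    by (intro exI[of _ "(!) ys"])
       (auto simp: inc_lists_def sorted_wrt_iff_nth_less nth_mem subset_iff)
qed

text \<open>The union of the two ends determines the edge, whichever end comes first, and the ends
  differ. So each edge is oriented by the value of \<open>f\<close> at a single list.\<close>

lemma orientation_from_predicate:
  assumes "trans r" "antisym r" and "1 \<le> n"
  defines "D f \<equiv> {(set (butlast ys), set (tl ys)) |ys. ys \<in> inc_lists r (Suc n) \<and> f ys} \<union>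
    {(set (tl ys), set (butlast ys)) |ys. ys \<in> inc_lists r (Suc n) \<and> \<not> f ys}"
  shows "is_orientation r n (D f)"
proof -
  have inj: "ys = zs" if "ys \<in> inc_lists r (Suc n)" "zs \<in> inc_lists r (Suc n)"
    "set (butlast ys) \<union> set (tl ys) = set (butlast zs) \<union> set (tl zs)" for ys zs
    using that inc_lists_set_inject[OF \<open>antisym r\<close>] inc_lists_Un_butlast_tl[OF _ \<open>1 \<le> n\<close>]
    by metis
  have fwd: "(set (butlast ys), set (tl ys)) \<in> D f \<longleftrightarrow> f ys"
    if ys: "ys \<in> inc_lists r (Suc n)" for ys
  proof
    assume "(set (butlast ys), set (tl ys)) \<in> D f"
    then consider zs where "zs \<in> inc_lists r (Suc n)" "f zs"
        "set (butlast ys) = set (butlast zs)" "set (tl ys) = set (tl zs)"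
      | zs where "zs \<in> inc_lists r (Suc n)"
        "set (butlast ys) = set (tl zs)" "set (tl ys) = set (butlast zs)"
      unfolding D_def by blast
    then show "f ys"
    proof cases
      case 1
      then show ?thesis using inj[OF ys, of zs] by auto
    next
      case 2
      then have "ys = zs" using inj[OF ys, of zs] by auto
      with 2 inc_lists_butlast_noteq_tl[OF ys \<open>1 \<le> n\<close>] show ?thesis by simp
    qed
  qed (use ys in \<open>auto simp: D_def\<close>)
  have bwd: "(set (tl ys), set (butlast ys)) \<in> D f \<longleftrightarrow> \<not> f ys"
    if ys: "ys \<in> inc_lists r (Suc n)" for ys
  proof
    assume "(set (tl ys), set (butlast ys)) \<in> D f"
    then consider zs where "zs \<in> inc_lists r (Suc n)" "\<not> f zs"
        "set (butlast ys) = set (butlast zs)" "set (tl ys) = set (tl zs)"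
      | zs where "zs \<in> inc_lists r (Suc n)"
        "set (butlast ys) = set (tl zs)" "set (tl ys) = set (butlast zs)"
      unfolding D_def by blast
    then show "\<not> f ys"
    proof cases
      case 1
      then show ?thesis using inj[OF ys, of zs] by auto
    next
      case 2
      then have "ys = zs" using inj[OF ys, of zs] by auto
      with 2 inc_lists_butlast_noteq_tl[OF ys \<open>1 \<le> n\<close>] show ?thesis by simp
    qed
  qed (use ys in \<open>auto simp: D_def\<close>)
  have "(X, Y) \<in> D f \<longleftrightarrow> (Y, X) \<notin> D f" if "shift_edge r n X Y" for X Y
    using that fwd bwd unfolding shift_edge_iff_inc_lists[OF assms(1,2)] by blast
  moreover have "shift_edge r n X Y \<or> shift_edge r n Y X" if "(X, Y) \<in> D f" for X Y
    using that unfolding shift_edge_iff_inc_lists[OF assms(1,2)] D_def by blast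
  ultimately show ?thesis
    unfolding is_orientation_def by blast
qed

section \<open>Edge colourings matched by every vertex colouring\<close>

text \<open>A vertex of the shift graph on \<open>m\<close>-tuples is an increasing list of length \<open>m\<close>, and an edge
  is an increasing list \<open>ys\<close> of length \<open>m + 1\<close>, joining \<open>butlast ys\<close> to \<open>tl ys\<close>.\<close>

definition matching_colouring :: "'v rel \<Rightarrow> nat \<Rightarrow> 's set \<Rightarrow> ('v list \<Rightarrow> 's) \<Rightarrow> bool" where
  "matching_colouring r m S p \<longleftrightarrow>
     (\<forall>ys\<in>inc_lists r (Suc m). p ys \<in> S) \<and>
     (\<forall>C. (\<forall>xs\<in>inc_lists r m. C xs \<in> S \<times> S) \<longrightarrow>
       (\<exists>ys\<in>inc_lists r (Suc m). C (butlast ys) = C (tl ys) \<and> fst (C (tl ys)) = p ys))"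

text \<open>On 1-tuples the shift graph is complete, so a splitting function on the points already
  is an edge colouring of the required kind.\<close>

lemma matching_colouring_one:
  assumes "total_on (Field r) r" and "infinite S"
    and "(card_of (Field r), card_of (Pow S)) \<in> ordIso"
  shows "\<exists>p. matching_colouring r 1 S p"
proof -
  obtain d :: "'a \<Rightarrow> 'a \<Rightarrow> 'b"
    where d: "\<forall>x y. d x y \<in> S" "\<forall>x y. d x y = d y x"
      "\<forall>C. (\<forall>x\<in>Field r. C x \<in> S \<times> S) \<longrightarrow>
        (\<exists>x\<in>Field r. \<exists>y\<in>Field r. x \<noteq> y \<and> C x = C y \<and> fst (C x) = d x y)"
    by (rule splitting_function_exists[OF assms(2,3)])
  have "\<exists>ys\<in>inc_lists r (Suc 1). C (butlast ys) = C (tl ys) \<and>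
      fst (C (tl ys)) = d (hd ys) (last ys)"
    if C: "\<forall>xs\<in>inc_lists r 1. C xs \<in> S \<times> S" for C
  proof -
    have "C [x] \<in> S \<times> S" if "x \<in> Field r" for x
      using C that by (auto simp: inc_lists_def)
    from d(3)[rule_format, of "\<lambda>x. C [x]", OF this] obtain x y where xy:
      "x \<in> Field r" "y \<in> Field r" "x \<noteq> y" "C [x] = C [y]" "fst (C [x]) = d x y"
      by blast
    have "(x, y) \<in> r \<or> (y, x) \<in> r"
      using xy assms(1) by (auto simp: total_on_def)
    then show ?thesis
    proof
      assume "(x, y) \<in> r"
      with xy show ?thesis
        by (intro bexI[of _ "[x, y]"]) (auto simp: inc_lists_def)
    next
      \<comment> \<open>The pair comes in no particular order; the symmetry of \<open>d\<close>
        allows listing it increasingly.\<close>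
      assume "(y, x) \<in> r"
      with xy d(2) show ?thesis
        by (intro bexI[of _ "[y, x]"]) (auto simp: inc_lists_def)
    qed
  qed
  then have "matching_colouring r 1 S (\<lambda>ys. d (hd ys) (last ys))"
    using d(1) by (simp add: matching_colouring_def)
  then show ?thesis by blast
qed

text \<open>If every vertex \<open>v\<close> missed a colour \<open>d v\<close>, then colouring \<open>v\<close> by \<open>d v\<close> together with the
  set of \<open>C\<close>-colours of its outgoing edges of \<open>p\<close>-colour \<open>d v\<close> would not be matched.\<close>

lemma matching_colouring_full_vertex:
  assumes p: "matching_colouring r m S p"
    and \<iota>: "inj_on \<iota> (Pow Z)" "\<iota> ` Pow Z \<subseteq> S"
    and C: "\<And>ys. ys \<in> inc_lists r (Suc m) \<Longrightarrow> C ys \<in> Z"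
  obtains v where "v \<in> inc_lists r m"
    and "\<And>s. s \<in> S \<Longrightarrow> \<exists>e\<in>inc_lists r (Suc m). \<exists>e'\<in>inc_lists r (Suc m).
      tl e = v \<and> butlast e' = v \<and> p e = s \<and> p e' = s \<and> C e = C e'"
proof (rule ccontr)
  assume neg: "\<not> thesis"
  let ?P = "\<lambda>v s. \<exists>e\<in>inc_lists r (Suc m). \<exists>e'\<in>inc_lists r (Suc m).
      tl e = v \<and> butlast e' = v \<and> p e = s \<and> p e' = s \<and> C e = C e'"
  have "\<forall>v\<in>inc_lists r m. \<exists>s. s \<in> S \<and> \<not> ?P v s"
    using neg that by blast
  from bchoice[OF this] obtain d
    where d: "\<And>v. v \<in> inc_lists r m \<Longrightarrow> d v \<in> S \<and> \<not> ?P v (d v)"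
    by blast
  define X where "X v = {C e |e. e \<in> inc_lists r (Suc m) \<and> butlast e = v \<and> p e = d v}" for v
  have X: "X v \<in> Pow Z" for v
    using C by (auto simp: X_def)
  have "\<forall>v\<in>inc_lists r m. (d v, \<iota> (X v)) \<in> S \<times> S"
    using d X \<iota>(2) by (simp add: image_subset_iff)
  then obtain ys where ys: "ys \<in> inc_lists r (Suc m)"
      "(d (butlast ys), \<iota> (X (butlast ys))) = (d (tl ys), \<iota> (X (tl ys)))"
      "fst (d (tl ys), \<iota> (X (tl ys))) = p ys"
    using p[unfolded matching_colouring_def, THEN conjunct2, rule_format,
        of "\<lambda>v. (d v, \<iota> (X v))"] by blast
  then have "X (butlast ys) = X (tl ys)"
    using inj_onD[OF \<iota>(1) _ X X] by simp
  \<comment> \<open>\<open>ys\<close> itself puts its colour into the set at its start, hence also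
    into the equal set at its end. So some \<open>e\<close> leaves \<open>tl ys\<close> with both
    colours of \<open>ys\<close>, and \<open>tl ys\<close> does not miss
    \<open>d (tl ys)\<close>.\<close>
  moreover have "C ys \<in> X (butlast ys)"
    using ys by (auto simp: X_def)
  ultimately have "C ys \<in> X (tl ys)"
    by simp
  then obtain e where "e \<in> inc_lists r (Suc m)" "butlast e = tl ys" "p e = d (tl ys)" "C e = C ys"
    unfolding X_def by auto
  moreover have "p ys = d (tl ys)"
    using ys by simp
  ultimately have "?P (tl ys) (d (tl ys))"
    using ys(1) by (intro bexI[of _ ys] bexI[of _ e]) auto
  with d[OF inc_lists_tl[OF ys(1)]] show False
    by blast
qed

text \<open>At a full vertex \<open>v\<close> each letter of \<open>S'\<close> labels an incoming
  and an outgoing edge with a common \<open>C\<close>-colour. \<open>C\<close> thus induces a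
  colouring of \<open>S'\<close> by pairs, to which the splitting function \<open>d\<close>
  applies.\<close>

lemma matching_colouring_Suc:
  fixes S :: "'s set" and S' :: "'t set"
  assumes "trans r" "antisym r" "1 \<le> m" and p: "matching_colouring r m S' p"
    and S: "infinite S" and S': "(card_of S', card_of (Pow S)) \<in> ordIso"
  shows "\<exists>q. matching_colouring r (Suc m) S q"
proof -
  obtain d :: "'t \<Rightarrow> 't \<Rightarrow> 's"
    where d: "\<forall>x y. d x y \<in> S" "\<forall>x y. d x y = d y x"
      "\<forall>C. (\<forall>x\<in>S'. C x \<in> S \<times> S) \<longrightarrow>
        (\<exists>x\<in>S'. \<exists>y\<in>S'. x \<noteq> y \<and> C x = C y \<and> fst (C x) = d x y)"
    by (rule splitting_function_exists[OF S S'])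
  obtain f where "bij_betw f S' (Pow (S \<times> S))"
    by (rule bij_betw_Pow_square[OF S S'])
  then have \<iota>: "inj_on (inv_into S' f) (Pow (S \<times> S))" "inv_into S' f ` Pow (S \<times> S) \<subseteq> S'"
    using bij_betw_inv_into[of f S'] by (auto simp: bij_betw_def)
  define q where "q zs = d (p (butlast zs)) (p (tl zs))" for zs
  have "\<exists>zs\<in>inc_lists r (Suc (Suc m)). C (butlast zs) = C (tl zs) \<and> fst (C (tl zs)) = q zs"
    if C: "\<forall>xs\<in>inc_lists r (Suc m). C xs \<in> S \<times> S" for C
  proof -
    obtain v where "v \<in> inc_lists r m"
      and v: "\<And>s. s \<in> S' \<Longrightarrow> \<exists>e\<in>inc_lists r (Suc m). \<exists>e'\<in>inc_lists r (Suc m).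
        tl e = v \<and> butlast e' = v \<and> p e = s \<and> p e' = s \<and> C e = C e'"
      by (rule matching_colouring_full_vertex[OF p \<iota>, of C]) (use C in blast)+
    have "\<forall>s\<in>S'. \<exists>e. e \<in> inc_lists r (Suc m) \<and> (\<exists>e'\<in>inc_lists r (Suc m).
        tl e = v \<and> butlast e' = v \<and> p e = s \<and> p e' = s \<and> C e = C e')"
      using v by blast
    from bchoice[OF this] obtain E where E: "\<And>s. s \<in> S' \<Longrightarrow> E s \<in> inc_lists r (Suc m) \<and>
        (\<exists>e'\<in>inc_lists r (Suc m).
        tl (E s) = v \<and> butlast e' = v \<and> p (E s) = s \<and> p e' = s \<and> C (E s) = C e')"
      by blast
    have "C (E s) \<in> S \<times> S" if "s \<in> S'" for s
      using E[OF that] C by blast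
    from d(3)[rule_format, of "\<lambda>s. C (E s)", OF this] obtain s t
      where st: "s \<in> S'" "t \<in> S'" "C (E s) = C (E t)" "fst (C (E s)) = d s t"
      by blast
    \<comment> \<open>The incoming edge of \<open>s\<close> meets the outgoing edge of
      \<open>t\<close> at \<open>v\<close>; glued, they have \<open>q\<close>-colour
      \<open>d s t\<close>.\<close>
    obtain e' where e': "e' \<in> inc_lists r (Suc m)" "butlast e' = v" "p e' = t" "C (E t) = C e'"
      using E[OF st(2)] by blast
    have Es: "E s \<in> inc_lists r (Suc m)" "tl (E s) = butlast e'" "p (E s) = s"
      using E[OF st(1)] e'(2) by auto
    obtain zs where "zs \<in> inc_lists r (Suc (Suc m))" "butlast zs = E s" "tl zs = e'"
      by (rule inc_lists_glue[OF assms(1-3) Es(1) e'(1) Es(2)])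
    then show ?thesis
      using st e' Es by (intro bexI[of _ zs]) (auto simp: q_def)
  qed
  then have "matching_colouring r (Suc m) S q"
    using d(1) by (simp add: matching_colouring_def q_def)
  then show ?thesis by blast
qed

section \<open>Iterated exponentials\<close>

text \<open>\<open>exp_card\<close> removes the topmost power set, whereas the iteration consumes
  the lowest one. Here the latter is realised inside the type of \<open>V\<close> and becomes the
  new base.\<close>

lemma exp_card_Suc_base:
  fixes K :: "'k set" and V :: "'v set"
  assumes "exp_card (Suc m) K V"
  obtains S :: "'v set" where "(card_of S, card_of (Pow K)) \<in> ordIso" and "exp_card m S V"
  using assms
proof (induction m arbitrary: V thesis)
  case 0
  then obtain C :: "'v set" where C: "(card_of C, card_of K) \<in> ordIso"
      "(card_of V, card_of (Pow C)) \<in> ordIso"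
    by auto
  then obtain h where "bij_betw h C K"
    using card_of_ordIso by blast
  then have "(card_of (Pow C), card_of (Pow K)) \<in> ordIso"
    using bij_betw_Pow card_of_ordIso by blast
  with C have "(card_of V, card_of (Pow K)) \<in> ordIso"
    using ordIso_transitive by blast
  \<comment> \<open>No exponential remains above the base, so \<open>V\<close> itself serves as
    \<open>S\<close>.\<close>
  then show ?case
    using 0(1) card_of_refl[of V] exp_card.simps(1) by blast
next
  case (Suc m)
  then obtain C :: "'v set" where C: "exp_card (Suc m) K C" "(card_of V, card_of (Pow C)) \<in> ordIso"
    by auto
  obtain S :: "'v set" where S: "(card_of S, card_of (Pow K)) \<in> ordIso" "exp_card m S C"
    using Suc.IH C(1) by blast
  then have "exp_card (Suc m) S V"
    using C(2) by auto
  with S(1) Suc.prems(1) show ?case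
    by blast
qed

lemma infinite_if_card_Pow:
  assumes "infinite A" "(card_of B, card_of (Pow A)) \<in> ordIso"
  shows "infinite B"
  using assms card_of_ordIso_finite finite_Pow_iff by blast

text \<open>Lengthening the tuples by one shrinks the colour set from the size of
  \<open>Pow S\<close> to that of \<open>S\<close>. Hence \<open>S\<close> varies in the induction,
  and the hypothesis is used for \<open>S'\<close> of size \<open>Pow S\<close>.\<close>

lemma matching_colouring_exists:
  fixes S :: "'v set" and r :: "'v rel"
  assumes "Linear_order r" and "infinite S" and "exp_card (Suc m) S (Field r)"
  shows "\<exists>p. matching_colouring r (Suc m) S p"
  using assms(2,3)
proof (induction m arbitrary: S)
  case 0
  obtain S' :: "'v set" where "(card_of S', card_of (Pow S)) \<in> ordIso" "exp_card 0 S' (Field r)"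
    by (rule exp_card_Suc_base[OF 0(2)])
  then have "(card_of (Field r), card_of (Pow S)) \<in> ordIso"
    using ordIso_transitive by auto
  then show ?case
    using matching_colouring_one[of r S] assms(1) 0(1) by (auto simp: linear_order_on_def)
next
  case (Suc m)
  obtain S' :: "'v set" where S': "(card_of S', card_of (Pow S)) \<in> ordIso"
      "exp_card (Suc m) S' (Field r)"
    by (rule exp_card_Suc_base[OF Suc.prems(2)])
  then obtain p where p: "matching_colouring r (Suc m) S' p"
    using Suc.IH infinite_if_card_Pow[OF Suc.prems(1)] by blast
  have "trans r" "antisym r"
    using assms(1) by (auto simp: linear_order_on_def partial_order_on_def preorder_on_def)
  from matching_colouring_Suc[OF this _ p Suc.prems(1) S'(1)] show ?case
    by simp
qed

section \<open>The orientation and its monochromatic 4-cycles\<close>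

lemma has_C4_in_not_acyclic: "has_C4_in D A \<Longrightarrow> \<not> acyclic_set D A"
proof
  assume "has_C4_in D A" "acyclic_set D A"
  then obtain a b c d where "(a, b) \<in> D \<inter> A \<times> A" "(b, c) \<in> D \<inter> A \<times> A"
      "(c, d) \<in> D \<inter> A \<times> A" "(d, a) \<in> D \<inter> A \<times> A"
    unfolding has_C4_in_def by blast
  then have "(a, a) \<in> (D \<inter> A \<times> A)\<^sup>+"
    by (meson trancl.intros)
  with \<open>acyclic_set D A\<close> show False
    by (auto simp: acyclic_set_def acyclic_def)
qed

theorem theorem4p5:
  fixes K :: "'k set" and r :: "'v rel" and n :: nat
  assumes "infinite K"
    and "2 \<le> n"
    and "card_order_on (Field r) r"
    and "exp_card n K (Field r)"
  shows "\<exists>D. is_orientation r n D \<and>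
           (\<forall>c :: 'v set \<Rightarrow> 'k. c ` shift_vertices r n \<subseteq> K \<longrightarrow>
              (\<exists>k\<in>K. has_C4_in D {X \<in> shift_vertices r n. c X = k})) \<and>
           (\<forall>c :: 'v set \<Rightarrow> 'k. c ` shift_vertices r n \<subseteq> K \<longrightarrow>
              (\<exists>k\<in>K. \<not> acyclic_set D {X \<in> shift_vertices r n. c X = k}))"
proof -
  obtain m where n: "n = Suc (Suc m)"
    using \<open>2 \<le> n\<close> by (metis Suc_le_D numeral_2_eq_2 Suc_le_mono)
  have lin: "Linear_order r"
    using assms(3) by (auto simp: card_order_on_def well_order_on_def)
  then have r: "trans r" "antisym r"
    by (auto simp: linear_order_on_def partial_order_on_def preorder_on_def)
  \<comment> \<open>The lowest exponential is set aside for the alphabet \<open>S\<close>; the other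
    \<open>n - 1\<close> yield a matching colouring on \<open>(n-1)\<close>-tuples.\<close>
  obtain S :: "'v set" where S: "(card_of S, card_of (Pow K)) \<in> ordIso"
      "exp_card (Suc m) S (Field r)"
    by (rule exp_card_Suc_base[OF assms(4)[unfolded n]])
  obtain p where p: "matching_colouring r (Suc m) S p"
    using matching_colouring_exists[OF lin infinite_if_card_Pow[OF assms(1) S(1)] S(2)] by blast
  obtain g :: "'v \<Rightarrow> 'v \<Rightarrow> bool" where g: "\<forall>C :: 'v \<Rightarrow> 'k. (\<forall>x\<in>S. C x \<in> K) \<longrightarrow>
    (\<exists>x\<in>S. \<exists>x'\<in>S. \<exists>y\<in>S. \<exists>y'\<in>S. C x = C y \<and> C x' = C y \<and> C y' = C y \<and>
      g x y \<and> \<not> g x' y \<and> g x' y' \<and> \<not> g x y')"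
    by (rule alternating_relation_exists[OF assms(1) S(1)])
  obtain h where "bij_betw h S (Pow K)"
    using S(1) card_of_ordIso by blast
  then have \<iota>: "inj_on (inv_into S h) (Pow K)" "inv_into S h ` Pow K \<subseteq> S"
    using bij_betw_inv_into[of h S] by (auto simp: bij_betw_def)
  \<comment> \<open>An edge \<open>zs\<close> on \<open>n\<close>-tuples consists of two consecutive
    edges on \<open>(n-1)\<close>-tuples; their \<open>p\<close>-colours are the arguments of
    \<open>g\<close>.\<close>
  define f where "f zs \<longleftrightarrow> g (p (butlast zs)) (p (tl zs))" for zs
  define D where "D = {(set (butlast ys), set (tl ys)) |ys. ys \<in> inc_lists r (Suc n) \<and> f ys} \<union>
    {(set (tl ys), set (butlast ys)) |ys. ys \<in> inc_lists r (Suc n) \<and> \<not> f ys}"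
  have orient: "is_orientation r n D"
    unfolding D_def using orientation_from_predicate[OF r, of n f] n by simp
  have C4: "\<exists>k\<in>K. has_C4_in D {X \<in> shift_vertices r n. c X = k}"
    if c: "c ` shift_vertices r n \<subseteq> K" for c :: "'v set \<Rightarrow> 'k"
  proof -
    have cK: "c (set ys) \<in> K" if "ys \<in> inc_lists r n" for ys
      using c inc_lists_set_vertex[OF that] by blast
    \<comment> \<open>A colouring of \<open>n\<close>-sets is an edge colouring of the graph on
      \<open>(n-1)\<close>-tuples. The full vertex is taken with \<open>Z = K\<close>, whose subsets
      are coded in \<open>S\<close> by \<open>inv_into S h\<close>.\<close>
    obtain v where "v \<in> inc_lists r (Suc m)"
      and v: "\<And>s. s \<in> S \<Longrightarrow> \<exists>e\<in>inc_lists r n. \<exists>e'\<in>inc_lists r n.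
        tl e = v \<and> butlast e' = v \<and> p e = s \<and> p e' = s \<and> c (set e) = c (set e')"
      using matching_colouring_full_vertex[OF p \<iota>, of "\<lambda>ys. c (set ys)"] cK
      unfolding n by blast
    have "\<forall>s\<in>S. \<exists>e. fst e \<in> inc_lists r n \<and> snd e \<in> inc_lists r n \<and> tl (fst e) = v \<and>
        butlast (snd e) = v \<and> p (fst e) = s \<and> p (snd e) = s \<and> c (set (fst e)) = c (set (snd e))"
      using v by fastforce
    from bchoice[OF this] obtain E where E: "\<And>s. s \<in> S \<Longrightarrow>
        fst (E s) \<in> inc_lists r n \<and> snd (E s) \<in> inc_lists r n \<and> tl (fst (E s)) = v \<and>
        butlast (snd (E s)) = v \<and> p (fst (E s)) = s \<and> p (snd (E s)) = s \<and>
        c (set (fst (E s))) = c (set (snd (E s)))"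
      by blast
    \<comment> \<open>Every \<open>L s\<close> enters \<open>v\<close> and every \<open>R t\<close>
      leaves it, so all of them are adjacent across the two sides, with directions dictated by
      \<open>g\<close>.\<close>
    define L where "L s = set (fst (E s))" for s
    define R where "R s = set (snd (E s))" for s
    have LR: "(L s, R t) \<in> D \<longleftrightarrow> g s t" "(R t, L s) \<in> D \<longleftrightarrow> \<not> g s t" "L s \<noteq> R t"
      if "s \<in> S" "t \<in> S" for s t
    proof -
      have e: "fst (E s) \<in> inc_lists r (Suc (Suc m))" "snd (E t) \<in> inc_lists r (Suc (Suc m))"
        "tl (fst (E s)) = butlast (snd (E t))"
        using E[OF that(1)] E[OF that(2)] n by auto
      obtain zs where zs: "zs \<in> inc_lists r (Suc n)" "butlast zs = fst (E s)" "tl zs = snd (E t)"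
        using inc_lists_glue[OF r _ e] n by auto
      have "f zs \<longleftrightarrow> g s t"
        using zs E[OF that(1)] E[OF that(2)] by (simp add: f_def)
      moreover have "(set (butlast zs), set (tl zs)) \<in> D" if "f zs"
        unfolding D_def using zs(1) that by blast
      moreover have "(set (tl zs), set (butlast zs)) \<in> D" if "\<not> f zs"
        unfolding D_def using zs(1) that by blast
      moreover have "shift_edge r n (set (butlast zs)) (set (tl zs))"
        using zs(1) unfolding shift_edge_iff_inc_lists[OF r] by blast
      then have "(set (butlast zs), set (tl zs)) \<in> D \<longleftrightarrow> (set (tl zs), set (butlast zs)) \<notin> D"
        using orient unfolding is_orientation_def by blast
      ultimately show "(L s, R t) \<in> D \<longleftrightarrow> g s t" "(R t, L s) \<in> D \<longleftrightarrow> \<not> g s t"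
        unfolding L_def R_def using zs(2,3) by auto
      show "L s \<noteq> R t"
        using inc_lists_butlast_noteq_tl[OF zs(1)] zs(2,3) n by (simp add: L_def R_def)
    qed
    have "c (L s) \<in> K" if "s \<in> S" for s
      unfolding L_def using E[OF that] cK by blast
    \<comment> \<open>A letter \<open>s\<close> is coloured by the common colour of
      \<open>L s\<close> and \<open>R s\<close>, so equal colours of letters make vertices on both
      sides monochromatic.\<close>
    from g[rule_format, of "\<lambda>s. c (L s)", OF this] obtain x x' y y' where
      S: "x \<in> S" "x' \<in> S" "y \<in> S" "y' \<in> S" and
      col: "c (L x) = c (L y)" "c (L x') = c (L y)" "c (L y') = c (L y)" and
      alt: "g x y" "\<not> g x' y" "g x' y'" "\<not> g x y'"
      by blast
    have vert: "L s \<in> shift_vertices r n" "R s \<in> shift_vertices r n" "c (R s) = c (L s)"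
      if "s \<in> S" for s
      using E[OF that] inc_lists_set_vertex by (auto simp: L_def R_def)
    have arcs: "(L x, R y) \<in> D" "(R y, L x') \<in> D" "(L x', R y') \<in> D" "(R y', L x) \<in> D"
      using LR S alt by auto
    \<comment> \<open>\<open>L x\<close> and \<open>L x'\<close> have opposite arcs with
      \<open>R y\<close>, as \<open>R y\<close> and \<open>R y'\<close> have with
      \<open>L x\<close>.\<close>
    have "L x \<noteq> L x'" "R y \<noteq> R y'"
      using LR S alt by metis+
    then have "distinct [L x, R y, L x', R y']"
      using LR(3) S by (auto dest: not_sym)
    moreover let ?A = "{X \<in> shift_vertices r n. c X = c (L y)}"
    have "L x \<in> ?A" "R y \<in> ?A" "L x' \<in> ?A" "R y' \<in> ?A"
      using vert S col by simp_all
    ultimately have "has_C4_in D ?A"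
      unfolding has_C4_in_def using arcs by blast
    moreover have "c (L y) \<in> K"
      using c vert(1)[OF S(3)] by blast
    ultimately show ?thesis
      by blast
  qed
  show ?thesis
    using orient C4 has_C4_in_not_acyclic by (intro exI[of _ D]) blast
qed

end
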